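(* Consider the two-stage robust linear program $$\mathrm{RO}_2 := \min_{x^1}\Big\{ c^{1\top}x^1 + \sup_{\xi^1\in\Xi^1}\Big[\min_{x^2(\xi^1)} c^{2\top}(\xi^1)\,x^2(\xi^1)\Big]\Big\}$$ subject to $Ax^1=h^1$, $x^1\ge 0$, and, for all $\xi^1\in\Xi^1$, $T^1(\xi^1)x^1+W^2(\xi^1)x^2(\xi^1)=h^2(\xi^1)$, $x^2(\xi^1)\ge 0$; the inner minimization, for given $x^1$ and $\xi^1$, is over the $x^2(\xi^1)$ satisfying the latter constraints. Consider also the robust problem with certificates $$\mathrm{RwC}_2 := \min_{x^1,\gamma}\ \gamma$$ subject to $Ax^1=h^1$, $x^1\ge 0$, and: for every $\xi^1\in\Xi^1$ there exists $x^2(\xi^1)\in\mathbb{R}^{n_2}$ satisfying $c^{1\top}x^1+c^{2\top}(\xi^1)x^2(\xi^1)\le\gamma$, $x^2(\xi^1)\ge 0$, and $T^1(\xi^1)x^1+W^2(\xi^1)x^2(\xi^1)=h^2(\xi^1)$. Then $\mathrm{RO}_2$ is equivalent to $\mathrm{RwC}_2$: the two problems have the same optimal value and the same optimal first-stage decisions $x^1$.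
   Context: $\Xi^1\subseteq\mathbb{R}^{n_1}$ is the support of the uncertain parameter $\xi^1$. The vectors $c^1\in\mathbb{R}^{n_1}$, $h^1\in\mathbb{R}^{m_1}$ and the matrix $A\in\mathbb{R}^{m_1\times n_1}$ are known. For each $\xi^1\in\Xi^1$, $c^2(\xi^1)\in\mathbb{R}^{n_2}$, $h^2(\xi^1)\in\mathbb{R}^{m_2}$, $T^1(\xi^1)\in\mathbb{R}^{m_2\times n_1}$, $W^2(\xi^1)\in\mathbb{R}^{m_2\times n_2}$. The decision $x^1\in\mathbb{R}^{n_1}$ is chosen before $\xi^1$ is revealed, and $x^2(\xi^1)\in\mathbb{R}^{n_2}$ after. Vector inequalities are componentwise. As the notation indicates, minima are understood as attained optima; a minimum over an empty set is $+\infty$. *)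

theory Defs
  imports "HOL-Analysis.Analysis"
begin

text \<open>
  Minimization problems with extended-real objectives. The value is the infimum, which is
  the minimum whenever one is attained and \<open>\<infinity>\<close> for an empty feasible set. An optimal solution
  attains the value, and this value has to be finite: a point with objective value \<open>\<infinity>\<close> or
  \<open>-\<infinity>\<close> does not count as optimal.
\<close>

definition opt_value :: "'a set \<Rightarrow> ('a \<Rightarrow> ereal) \<Rightarrow> ereal" where
  "opt_value S f = (INF x\<in>S. f x)"

definition opt_solutions :: "'a set \<Rightarrow> ('a \<Rightarrow> ereal) \<Rightarrow> 'a set" where
  "opt_solutions S f = {x \<in> S. \<bar>f x\<bar> \<noteq> \<infinity> \<and> (\<forall>y\<in>S. f x \<le> f y)}"

lemma opt_value_empty: "opt_value {} f = \<infinity>"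
  by (simp add: opt_value_def top_ereal_def)

lemma opt_value_attained:
  assumes "x \<in> S" and "\<And>y. y \<in> S \<Longrightarrow> f x \<le> f y"
  shows "opt_value S f = f x"
  unfolding opt_value_def using assms by (intro antisym INF_lower INF_greatest) auto

text \<open>The order on \<^typ>\<open>real ^ 'n\<close> is the componentwise one.\<close>

definition first_stage :: "real ^ 'n1 ^ 'm1 \<Rightarrow> real ^ 'm1 \<Rightarrow> (real ^ 'n1) set" where
  "first_stage A h1 = {x. A *v x = h1 \<and> 0 \<le> x}"

definition second_stage ::
  "('u \<Rightarrow> real ^ 'm2) \<Rightarrow> ('u \<Rightarrow> real ^ 'n1 ^ 'm2) \<Rightarrow> ('u \<Rightarrow> real ^ 'n2 ^ 'm2)
    \<Rightarrow> real ^ 'n1 \<Rightarrow> 'u \<Rightarrow> (real ^ 'n2) set" where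
  "second_stage h2 T W x \<xi> = {y. T \<xi> *v x + W \<xi> *v y = h2 \<xi> \<and> 0 \<le> y}"

definition recourse ::
  "('u \<Rightarrow> real ^ 'n2) \<Rightarrow> ('u \<Rightarrow> real ^ 'm2) \<Rightarrow> ('u \<Rightarrow> real ^ 'n1 ^ 'm2)
    \<Rightarrow> ('u \<Rightarrow> real ^ 'n2 ^ 'm2) \<Rightarrow> real ^ 'n1 \<Rightarrow> 'u \<Rightarrow> ereal" where
  "recourse c2 h2 T W x \<xi> = opt_value (second_stage h2 T W x \<xi>) (\<lambda>y. ereal (c2 \<xi> \<bullet> y))"

text \<open>
  A first-stage decision admitting no feasible second-stage decision for some \<open>\<xi> \<in> \<Xi>\<close> has
  objective value \<open>\<infinity>\<close>, so the second-stage constraints are imposed through the objective.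
\<close>

definition RO2_objective ::
  "'u set \<Rightarrow> real ^ 'n1 \<Rightarrow> ('u \<Rightarrow> real ^ 'n2) \<Rightarrow> ('u \<Rightarrow> real ^ 'm2)
    \<Rightarrow> ('u \<Rightarrow> real ^ 'n1 ^ 'm2) \<Rightarrow> ('u \<Rightarrow> real ^ 'n2 ^ 'm2) \<Rightarrow> real ^ 'n1 \<Rightarrow> ereal" where
  "RO2_objective \<Xi> c1 c2 h2 T W x = ereal (c1 \<bullet> x) + (SUP \<xi>\<in>\<Xi>. recourse c2 h2 T W x \<xi>)"

definition RwC2_feasible ::
  "'u set \<Rightarrow> real ^ 'n1 \<Rightarrow> real ^ 'n1 ^ 'm1 \<Rightarrow> real ^ 'm1 \<Rightarrow> ('u \<Rightarrow> real ^ 'n2)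
    \<Rightarrow> ('u \<Rightarrow> real ^ 'm2) \<Rightarrow> ('u \<Rightarrow> real ^ 'n1 ^ 'm2) \<Rightarrow> ('u \<Rightarrow> real ^ 'n2 ^ 'm2)
    \<Rightarrow> ((real ^ 'n1) \<times> real) set" where
  "RwC2_feasible \<Xi> c1 A h1 c2 h2 T W =
    {(x, \<gamma>). A *v x = h1 \<and> 0 \<le> x \<and>
      (\<forall>\<xi>\<in>\<Xi>. \<exists>y. c1 \<bullet> x + c2 \<xi> \<bullet> y \<le> \<gamma> \<and> 0 \<le> y \<and> T \<xi> *v x + W \<xi> *v y = h2 \<xi>)}"

definition RwC2_objective :: "(real ^ 'n1) \<times> real \<Rightarrow> ereal" where
  "RwC2_objective = (\<lambda>(x, \<gamma>). ereal \<gamma>)"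

end

theory Submission
  imports Defs
begin

text \<open>
  For \<open>x\<close> in the first stage, \<open>(x, \<gamma>)\<close> is feasible for the problem with certificates iff the
  robust objective at \<open>x\<close> is at most \<open>\<gamma>\<close>, so the second problem minimizes over the epigraph of
  the objective of the first. The direction from objective to certificate requires that a linear
  program with finite value attains it. The image of the nonnegative orthant under
  \<open>y \<mapsto> (W y, c \<bullet> y)\<close> is a finitely generated cone and therefore closed, so its
  slice over a fixed right-hand side is closed as well.
\<close>

text \<open>Exhibits finitely many generators, a property that passes to linear images.\<close>

lemma nonneg_orthant_eq_convex_cone_hull:
  "{y :: real ^ 'n. 0 \<le> y} = convex_cone hull (range (\<lambda>i. axis i 1))"
proof (intro subset_antisym subsetI)
  fix y :: "real ^ 'n"
  assume "y \<in> {y. 0 \<le> y}"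
  then have nonneg: "0 \<le> y $ i" for i
    by (simp add: less_eq_vec_def)
  let ?C = "convex_cone hull (range (\<lambda>i :: 'n. axis i (1 :: real)))"
  \<comment> \<open>Partial sums over \<open>I\<close> allow an induction that uses only
    \<open>0\<close>, binary sums and nonnegative multiples; \<open>I = UNIV\<close> recovers
    \<open>y\<close>.\<close>
  have "(\<Sum>i\<in>I. y $ i *\<^sub>R axis i 1) \<in> ?C" if "finite I" for I
    using that
    by induction
      (simp_all add: convex_cone_hull_contains_0 convex_cone_hull_add convex_cone_hull_mul
        nonneg hull_inc)
  from this[of UNIV] show "y \<in> ?C"
    by (simp add: basis_expansion scalar_mult_eq_scaleR[symmetric])
next
  fix y :: "real ^ 'n"
  assume "y \<in> convex_cone hull (range (\<lambda>i. axis i 1))"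
  moreover have "convex_cone hull (range (\<lambda>i :: 'n. axis i (1 :: real))) \<subseteq> {y. 0 \<le> y}"
    by (rule hull_minimal)
      (auto simp: convex_cone_iff less_eq_vec_def axis_def)
  ultimately show "y \<in> {y. 0 \<le> y}"
    by blast
qed

text \<open>Linear images of closed cones can fail to be closed. Here the image is generated by the
  finitely many vectors \<open>f (axis i 1)\<close>, which forces closedness.\<close>

lemma closed_linear_image_nonneg_orthant:
  fixes f :: "real ^ 'n \<Rightarrow> 'a :: euclidean_space"
  assumes "linear f"
  shows "closed (f ` {y. 0 \<le> y})"
proof -
  have "f ` {y. 0 \<le> y} = convex_cone hull (f ` range (\<lambda>i. axis i 1))"
    unfolding nonneg_orthant_eq_convex_cone_hull
    by (rule convex_cone_hull_linear_image[OF assms, symmetric])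
  then show ?thesis
    by (simp add: closed_convex_cone_hull)
qed

lemma closed_linear_program_values:
  fixes c :: "real ^ 'n" and W :: "real ^ 'n ^ 'm"
  shows "closed ((\<lambda>y. c \<bullet> y) ` {y. W *v y = b \<and> 0 \<le> y})"
proof -
  let ?f = "\<lambda>y. (W *v y, c \<bullet> y)"
  have "linear ?f"
    by (intro linearI) (simp_all add: matrix_vector_right_distrib inner_add_right
        matrix_vector_mult_scaleR)
  then have "closed (Pair b -` (?f ` {y. 0 \<le> y}))"
    by (intro closed_vimage closed_linear_image_nonneg_orthant continuous_intros)
  moreover have "Pair b -` (?f ` {y. 0 \<le> y}) = (\<lambda>y. c \<bullet> y) ` {y. W *v y = b \<and> 0 \<le> y}"
    by auto
  ultimately show ?thesis
    by simp
qed

text \<open>Attainment phrased as a comparison with a real \<open>r\<close>, which also covers the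
  infinite values: at \<infinity> both sides fail, at -\<infinity> both hold.\<close>

lemma INF_ereal_le_iff_if_closed:
  fixes f :: "'a \<Rightarrow> real"
  assumes "closed (f ` S)"
  shows "(INF y\<in>S. ereal (f y)) \<le> ereal r \<longleftrightarrow> (\<exists>y\<in>S. f y \<le> r)"
proof
  assume le: "(INF y\<in>S. ereal (f y)) \<le> ereal r"
  have near: "\<exists>y\<in>S. f y < r + e" if "e > 0" for e
  proof -
    have "(INF y\<in>S. ereal (f y)) < ereal (r + e)"
      by (rule le_less_trans[OF le]) (simp add: that)
    then show ?thesis
      by (auto simp: INF_less_iff)
  qed
  show "\<exists>y\<in>S. f y \<le> r"
  proof (rule ccontr)
    assume contr: "\<not> (\<exists>y\<in>S. f y \<le> r)"
    \<comment> \<open>All values exceed \<open>r\<close>, yet some lie below \<open>r + e\<close>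
      for each \<open>e > 0\<close>; closedness then puts \<open>r\<close> itself among the
      values.\<close>
    have "r \<in> closure (f ` S)"
      unfolding closure_approachable
    proof (intro allI impI)
      fix e :: real
      assume "e > 0"
      with near obtain y where "y \<in> S" "f y < r + e"
        by blast
      with contr show "\<exists>z\<in>f ` S. dist z r < e"
        by (force simp: dist_real_def)
    qed
    with assms contr show False
      by auto
  qed
next
  assume "\<exists>y\<in>S. f y \<le> r"
  then show "(INF y\<in>S. ereal (f y)) \<le> ereal r"
    by (meson INF_lower2 ereal_less_eq(3))
qed

lemma recourse_le_iff:
  "recourse c2 h2 T W x \<xi> \<le> ereal r \<longleftrightarrow> (\<exists>y\<in>second_stage h2 T W x \<xi>. c2 \<xi> \<bullet> y \<le> r)"
proof -
  \<comment> \<open>With \<open>x\<close> and \<open>\<xi>\<close> fixed, the term in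
    \<open>x\<close> moves to the right-hand side, leaving a linear program in standard
    form.\<close>
  have "second_stage h2 T W x \<xi> = {y. W \<xi> *v y = h2 \<xi> - T \<xi> *v x \<and> 0 \<le> y}"
    by (auto simp: second_stage_def algebra_simps)
  then have "closed ((\<lambda>y. c2 \<xi> \<bullet> y) ` second_stage h2 T W x \<xi>)"
    by (simp add: closed_linear_program_values)
  then show ?thesis
    unfolding recourse_def opt_value_def by (rule INF_ereal_le_iff_if_closed)
qed

lemma RwC2_feasible_eq_epigraph:
  "RwC2_feasible \<Xi> c1 A h1 c2 h2 T W =
    {(x, \<gamma>). x \<in> first_stage A h1 \<and> RO2_objective \<Xi> c1 c2 h2 T W x \<le> ereal \<gamma>}"
proof -
  have "RO2_objective \<Xi> c1 c2 h2 T W x \<le> ereal \<gamma> \<longleftrightarrow>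
      (\<forall>\<xi>\<in>\<Xi>. \<exists>y. c1 \<bullet> x + c2 \<xi> \<bullet> y \<le> \<gamma> \<and> 0 \<le> y \<and> T \<xi> *v x + W \<xi> *v y = h2 \<xi>)" for x \<gamma>
  proof -
    \<comment> \<open>Since \<open>a\<close> is finite, it can be subtracted even when
      \<open>s\<close> is infinite.\<close>
    have "ereal a + s \<le> ereal \<gamma> \<longleftrightarrow> s \<le> ereal (\<gamma> - a)" for a s
      by (cases s) auto
    then have "RO2_objective \<Xi> c1 c2 h2 T W x \<le> ereal \<gamma> \<longleftrightarrow>
        (\<forall>\<xi>\<in>\<Xi>. recourse c2 h2 T W x \<xi> \<le> ereal (\<gamma> - c1 \<bullet> x))"
      unfolding RO2_objective_def by (simp add: SUP_le_iff)
    then show ?thesis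
      unfolding recourse_le_iff by (auto simp: second_stage_def algebra_simps Bex_def conj_commute)
  qed
  then show ?thesis
    by (auto simp: RwC2_feasible_def first_stage_def)
qed

lemma opt_value_epigraph:
  "opt_value {(x, \<gamma>). x \<in> S \<and> f x \<le> ereal \<gamma>} (\<lambda>(x, \<gamma>). ereal \<gamma>) = opt_value S f"
  unfolding opt_value_def
proof (rule antisym)
  \<comment> \<open>A bound by \<open>f x\<close> is tested against all real \<open>\<gamma>\<close>
    above \<open>f x\<close>: there are none if \<open>f x\<close> is \<infinity>, and arbitrarily
    low ones if it is -\<infinity>.\<close>
  show "(INF (x, \<gamma>)\<in>{(x, \<gamma>). x \<in> S \<and> f x \<le> ereal \<gamma>}. ereal \<gamma>) \<le> (INF x\<in>S. f x)"
  proof (rule INF_greatest, rule ereal_le_real)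
    fix x \<gamma>
    assume "x \<in> S" "f x \<le> ereal \<gamma>"
    then show "(INF (x, \<gamma>)\<in>{(x, \<gamma>). x \<in> S \<and> f x \<le> ereal \<gamma>}. ereal \<gamma>) \<le> ereal \<gamma>"
      by (auto intro: INF_lower2[of "(x, \<gamma>)"])
  qed
next
  show "(INF x\<in>S. f x) \<le> (INF (x, \<gamma>)\<in>{(x, \<gamma>). x \<in> S \<and> f x \<le> ereal \<gamma>}. ereal \<gamma>)"
    by (rule INF_greatest) (clarsimp, rule INF_lower2)
qed

lemma opt_solutions_epigraph:
  "fst ` opt_solutions {(x, \<gamma>). x \<in> S \<and> f x \<le> ereal \<gamma>} (\<lambda>(x, \<gamma>). ereal \<gamma>) = opt_solutions S f"
    (is "fst ` opt_solutions ?E ?g = _")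
proof (intro subset_antisym subsetI)
  fix x
  assume "x \<in> fst ` opt_solutions ?E ?g"
  then obtain \<gamma> where x: "x \<in> S" "f x \<le> ereal \<gamma>"
    and min: "\<And>y \<delta>. y \<in> S \<Longrightarrow> f y \<le> ereal \<delta> \<Longrightarrow> ereal \<gamma> \<le> ereal \<delta>"
    by (auto simp: opt_solutions_def)
  \<comment> \<open>Testing against real \<open>\<delta>\<close> above \<open>f y\<close> rules out
    the value -\<infinity>; the case \<open>y = x\<close> then forces
    \<open>f x = ereal \<gamma>\<close>.\<close>
  have lower: "ereal \<gamma> \<le> f y" if "y \<in> S" for y
    by (rule ereal_le_real) (use min that in blast)
  with x have "f x = ereal \<gamma>"
    by (simp add: antisym)
  with x lower show "x \<in> opt_solutions S f"
    by (simp add: opt_solutions_def)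
next
  fix x
  assume x: "x \<in> opt_solutions S f"
  \<comment> \<open>The finiteness demanded by \<open>opt_solutions\<close> supplies the real second
    component of the optimal pair.\<close>
  then obtain \<gamma> where "f x = ereal \<gamma>"
    by (auto simp: opt_solutions_def)
  moreover have "f x \<le> ereal \<delta>" if "y \<in> S" "f y \<le> ereal \<delta>" for y \<delta>
    using x that by (auto simp: opt_solutions_def intro: order_trans)
  ultimately have "(x, \<gamma>) \<in> opt_solutions ?E ?g"
    using x by (auto simp: opt_solutions_def)
  then show "x \<in> fst ` opt_solutions ?E ?g"
    by force
qed

theorem theorem1:
  fixes \<Xi> :: "(real ^ 'n1) set"
    and c1 :: "real ^ 'n1" and A :: "real ^ 'n1 ^ 'm1" and h1 :: "real ^ 'm1"
    and c2 :: "real ^ 'n1 \<Rightarrow> real ^ 'n2" and h2 :: "real ^ 'n1 \<Rightarrow> real ^ 'm2"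
    and T :: "real ^ 'n1 \<Rightarrow> real ^ 'n1 ^ 'm2" and W :: "real ^ 'n1 \<Rightarrow> real ^ 'n2 ^ 'm2"
  shows "opt_value (first_stage A h1) (RO2_objective \<Xi> c1 c2 h2 T W)
           = opt_value (RwC2_feasible \<Xi> c1 A h1 c2 h2 T W) RwC2_objective
       \<and> opt_solutions (first_stage A h1) (RO2_objective \<Xi> c1 c2 h2 T W)
           = fst ` opt_solutions (RwC2_feasible \<Xi> c1 A h1 c2 h2 T W) RwC2_objective"
  unfolding RwC2_feasible_eq_epigraph RwC2_objective_def
  by (simp only: opt_value_epigraph opt_solutions_epigraph simp_thms)

end
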